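(* Let $\Sigma=\mathcal{A}^{\mathbb{N}}$ be a full shift, let $0<\theta<1$, and let $\varphi:\Sigma\to\mathbb{R}$ and $|\varphi|_\theta\ge 0$ satisfy $\operatorname{var}_n(\varphi)\le|\varphi|_\theta\,\theta^n$ for all $n\ge 1$. Let $\mu_\varphi$ be the Gibbs state for $\varphi$ and let $\pi:\Sigma\to Y$ be a $1$-block factor map. Then for any $\sigma$ with $\theta<\sigma<1$, the projected measure $\pi_*\mu_\varphi$ is a Gibbs state for a function $\psi:Y\to\mathbb{R}$ with $\operatorname{var}_n(\psi)=O(\eta^n)$, where $$\eta=\tanh\left(\frac12\left(\log\frac{1+\sigma}{1-\sigma}+\sigma\,\frac{|\varphi|_\theta\,\theta}{\sigma-\theta}\right)\right).$$
   Context: $\mathcal{A},\mathcal{B}$ are finite alphabets and $\mathbb{N}=\{0,1,2,\dots\}$. A map $\pi:\mathcal{A}\to\mathcal{B}$ induces the $1$-block factor map $\pi:\mathcal{A}^{\mathbb{N}}\to Y$, $\pi(x)_k=\pi(x_k)$, where $Y=\pi(\mathcal{A}^{\mathbb{N}})\subseteq\mathcal{B}^{\mathbb{N}}$ (so $Y=\pi(\mathcal{A})^{\mathbb{N}}$). For a function $\psi$ on a one-sided shift space $X$, $\operatorname{var}_n(\psi)=\sup\{|\psi(x)-\psi(y)|: x,y\in X,\ x_i=y_i \text{ for } 0\le i\le n-1\}$. A shift-invariant Borel probability measure $\mu$ on $X$ is a Gibbs state for $\psi$ if there are constants $C\ge1$ and $P\in\mathbb{R}$ such that $C^{-1}\le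 \mu([x_0\cdots x_{n-1}])/\exp(-Pn+\sum_{k=0}^{n-1}\psi(T^kx))\le C$ for all $x\in X$ and $n\ge1$, where $[x_0\cdots x_{n-1}]$ is the cylinder set of points of $X$ beginning with $x_0\cdots x_{n-1}$ and $T$ is the left shift. For $\varphi$ as in the claim the Gibbs state exists and is unique and is denoted $\mu_\varphi$. The projected measure is $\pi_*\mu_\varphi(E)=\mu_\varphi(\pi^{-1}E)$. *)

theory Defs
  imports "HOL-Probability.Probability"
begin

text \<open>A finite alphabet is a type of class \<^class>\<open>finite\<close>, and a one-sided shift space
  is a set \<open>X\<close> of sequences of type \<open>nat \<Rightarrow> 'a\<close>.\<close>

definition left_shift :: "(nat \<Rightarrow> 'a) \<Rightarrow> nat \<Rightarrow> 'a" where
  "left_shift x = (\<lambda>k. x (Suc k))"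

definition block_map :: "('a \<Rightarrow> 'b) \<Rightarrow> (nat \<Rightarrow> 'a) \<Rightarrow> nat \<Rightarrow> 'b" where
  "block_map p x = (\<lambda>k. p (x k))"

definition cylinder :: "(nat \<Rightarrow> 'a) set \<Rightarrow> nat \<Rightarrow> (nat \<Rightarrow> 'a) \<Rightarrow> (nat \<Rightarrow> 'a) set" where
  "cylinder X n x = {y \<in> X. \<forall>i<n. y i = x i}"

definition shift_topology :: "(nat \<Rightarrow> 'a) set \<Rightarrow> (nat \<Rightarrow> 'a) topology" where
  "shift_topology X = subtopology (product_topology (\<lambda>_. discrete_topology UNIV) UNIV) X"

definition shift_borel :: "(nat \<Rightarrow> 'a) set \<Rightarrow> (nat \<Rightarrow> 'a) measure" where
  "shift_borel X = sigma X {U. openin (shift_topology X) U}"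

text \<open>The variation takes values in \<^typ>\<open>ereal\<close>, so that it is \<open>\<infinity>\<close> when the differences are
  unbounded; an upper bound by a real number therefore includes boundedness.\<close>

definition var :: "(nat \<Rightarrow> 'a) set \<Rightarrow> nat \<Rightarrow> ((nat \<Rightarrow> 'a) \<Rightarrow> real) \<Rightarrow> ereal" where
  "var X n \<psi> = Sup {ereal \<bar>\<psi> x - \<psi> y\<bar> | x y. x \<in> X \<and> y \<in> X \<and> (\<forall>i<n. x i = y i)}"

definition gibbs_state ::
    "(nat \<Rightarrow> 'a) set \<Rightarrow> ((nat \<Rightarrow> 'a) \<Rightarrow> real) \<Rightarrow> (nat \<Rightarrow> 'a) measure \<Rightarrow> bool" where
  "gibbs_state X \<psi> \<mu> \<longleftrightarrow>
     prob_space \<mu> \<and> sets \<mu> = sets (shift_borel X) \<and>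
     (\<forall>E\<in>sets \<mu>. measure \<mu> {x \<in> X. left_shift x \<in> E} = measure \<mu> E) \<and>
     (\<exists>C P. C \<ge> 1 \<and>
        (\<forall>x\<in>X. \<forall>n\<ge>1.
           let r = measure \<mu> (cylinder X n x) /
                   exp (- P * real n + (\<Sum>k<n. \<psi> ((left_shift ^^ k) x)))
           in inverse C \<le> r \<and> r \<le> C))"

end

theory Submission
  imports Defs
begin

text \<open>For a word \<open>b\<^sub>0\<dots>b\<^sub>n\<^sub>-\<^sub>1\<close> over \<open>\<B>\<close> the Gibbs bounds make the projected mass of its cylinder comparable
  to \<open>exp (- P n)\<close> times \<open>Z\<^sub>n(b) = L\<^bsub>b(n-1)\<^esub> \<cdots> L\<^bsub>b(0)\<^esub> 1\<close>, where \<open>L\<^sub>b\<close> is the transfer operator of \<open>\<phi>\<close>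
  restricted to preimages starting in the fibre of \<open>b\<close>. The operators \<open>L\<^sub>b\<close> map a cone of positive functions
  with controlled oscillation into a subcone of finite Hilbert diameter \<open>\<Delta>\<close> with \<open>\<eta> = tanh (\<Delta> / 4)\<close>, so by
  Birkhoff's contraction theorem \<open>Z\<^sub>n\<^sub>+\<^sub>1(b) / Z\<^sub>n(T b)\<close> converges at rate \<open>\<eta>\<^sup>n\<close>. The logarithm of the limit
  is \<open>\<psi>\<close>: its variation is \<open>O(\<eta>\<^sup>n)\<close> because the \<open>n\<close>-th quotient depends on finitely many letters only, and
  \<open>ln Z\<^sub>n\<close> telescopes into the Birkhoff sum of \<open>\<psi>\<close> up to a convergent geometric series.\<close>

section \<open>Cones of functions with controlled oscillation\<close>

text \<open>Away from the zero function this says that ln f has \<open>n\<close>-th variation at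
  most \<open>c * \<theta> ^ n\<close>, also for \<open>n = 0\<close>, so that \<open>f\<close> is
  pinched between its infimum and \<open>exp c\<close> times it. The multiplicative form makes the
  set a convex cone containing zero.\<close>

definition osc_cone :: "real \<Rightarrow> real \<Rightarrow> ((nat \<Rightarrow> 'a) \<Rightarrow> real) set" where
  "osc_cone \<theta> c = {f. (\<forall>x. 0 \<le> f x) \<and>
     (\<forall>n x y. (\<forall>i<n. x i = y i) \<longrightarrow> f x \<le> exp (c * \<theta> ^ n) * f y)}"

lemma osc_coneI:
  assumes "\<And>x. 0 \<le> f x"
    and "\<And>n x y. (\<And>i. i < n \<Longrightarrow> x i = y i) \<Longrightarrow> f x \<le> exp (c * \<theta> ^ n) * f y"
  shows "f \<in> osc_cone \<theta> c"
  using assms unfolding osc_cone_def by blast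

lemma osc_cone_nonneg: "f \<in> osc_cone \<theta> c \<Longrightarrow> 0 \<le> f x"
  unfolding osc_cone_def by blast

lemma osc_cone_le:
  "f \<in> osc_cone \<theta> c \<Longrightarrow> (\<And>i. i < n \<Longrightarrow> x i = y i) \<Longrightarrow> f x \<le> exp (c * \<theta> ^ n) * f y"
  unfolding osc_cone_def by blast

lemma osc_cone_le0: "f \<in> osc_cone \<theta> c \<Longrightarrow> f x \<le> exp c * f y"
  using osc_cone_le[of f \<theta> c 0 x y] by simp

lemma osc_cone_scale:
  assumes "f \<in> osc_cone \<theta> c" "0 \<le> s"
  shows "(\<lambda>x. s * f x) \<in> osc_cone \<theta> c"
proof (rule osc_coneI)
  show "0 \<le> s * f x" for x
    using osc_cone_nonneg[OF assms(1)] assms(2) by simp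
  show "s * f x \<le> exp (c * \<theta> ^ n) * (s * f y)" if "\<And>i. i < n \<Longrightarrow> x i = y i" for n x y
    using mult_left_mono[OF osc_cone_le[OF assms(1) that] assms(2)] by (simp add: mult_ac)
qed

lemma osc_cone_zero: "(\<lambda>x. 0) \<in> osc_cone \<theta> c"
  by (rule osc_coneI) auto

lemma osc_cone_one: "0 \<le> c \<Longrightarrow> 0 \<le> \<theta> \<Longrightarrow> (\<lambda>x. 1) \<in> osc_cone \<theta> c"
  by (rule osc_coneI) auto

section \<open>Comparability of functions in the smaller cone\<close>

text \<open>Convexity of \<open>exp\<close>: \<open>\<sigma> * t\<close> is the convex combination
  of \<open>- (\<sigma> * t)\<close> and \<open>t\<close> with weight
  \<open>l = 2 * \<sigma> / (1 + \<sigma>)\<close> on \<open>t\<close>.\<close>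

lemma exp_gap_ratio:
  fixes \<sigma> t :: real
  assumes "0 \<le> \<sigma>" "\<sigma> \<le> 1"
  shows "(1 - \<sigma>) * (exp t - exp (- (\<sigma> * t))) \<le> (1 + \<sigma>) * (exp t - exp (\<sigma> * t))"
proof -
  have pos: "1 + \<sigma> > 0"
    using assms by simp
  define l where "l = 2 * \<sigma> / (1 + \<sigma>)"
  have l: "0 \<le> l" "l \<le> 1" "1 - l = (1 - \<sigma>) / (1 + \<sigma>)"
    using assms by (auto simp: l_def field_simps)
  have "l * (1 + \<sigma>) = 2 * \<sigma>"
    using pos by (simp add: l_def)
  then have "t * (l * (1 + \<sigma>)) = t * (2 * \<sigma>)"
    by simp
  then have eq: "(1 - l) * (- (\<sigma> * t)) + l * t = \<sigma> * t"
    by (simp add: algebra_simps)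
  have "exp (\<sigma> * t) \<le> (1 - l) * exp (- (\<sigma> * t)) + l * exp t"
    using convex_onD[OF exp_convex l(1,2), of "- (\<sigma> * t)" t] eq by simp
  then have "(1 + \<sigma>) * exp (\<sigma> * t) \<le> (1 + \<sigma>) * ((1 - l) * exp (- (\<sigma> * t)) + l * exp t)"
    using pos by (intro mult_left_mono) auto
  also have "\<dots> = (1 + \<sigma>) * (1 - l) * exp (- (\<sigma> * t)) + (1 + \<sigma>) * l * exp t"
    by (simp add: algebra_simps)
  also have "\<dots> = (1 - \<sigma>) * exp (- (\<sigma> * t)) + 2 * \<sigma> * exp t"
    using pos by (simp add: l(3)) (simp add: l_def)
  finally show ?thesis
    by (simp add: algebra_simps)
qed

text \<open>Membership of \<open>u\<close> in the smaller cone leaves the slack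
  \<open>exp t - exp (\<sigma> * t)\<close> at \<open>t = c * \<theta> ^ n\<close>, and by
  \<open>exp_gap_ratio\<close> this pays for the subtraction. The factor
  \<open>(1 - \<sigma>) / (1 + \<sigma>)\<close> suits every \<open>t\<close>, hence all
  \<open>n\<close> at once.\<close>

lemma osc_cone_diff:
  assumes u: "u \<in> osc_cone \<theta> (\<sigma> * c)" and v: "v \<in> osc_cone \<theta> (\<sigma> * c)"
    and le: "\<And>x. s * v x \<le> u x" and s: "0 \<le> s"
    and par: "0 \<le> \<sigma>" "\<sigma> < 1" "0 \<le> c" "0 \<le> \<theta>"
  shows "(\<lambda>x. u x - (1 - \<sigma>) / (1 + \<sigma>) * s * v x) \<in> osc_cone \<theta> c"
proof (rule osc_coneI)
  define \<kappa> where "\<kappa> = (1 - \<sigma>) / (1 + \<sigma>)"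
  have \<kappa>: "0 \<le> \<kappa>" "\<kappa> \<le> 1"
    using par by (auto simp: \<kappa>_def field_simps)
  show "0 \<le> u x - (1 - \<sigma>) / (1 + \<sigma>) * s * v x" for x
  proof -
    have "\<kappa> * (s * v x) \<le> 1 * (s * v x)"
      using \<kappa> s osc_cone_nonneg[OF v] by (intro mult_right_mono) auto
    then show ?thesis
      using le[of x] unfolding \<kappa>_def[symmetric] by (simp add: mult.assoc)
  qed
  fix n and x y :: "nat \<Rightarrow> 'a"
  assume xy: "\<And>i. i < n \<Longrightarrow> x i = y i"
  define t where "t = c * \<theta> ^ n"
  have t: "0 \<le> t"
    using par by (simp add: t_def)
  have st: "\<sigma> * c * \<theta> ^ n = \<sigma> * t"
    by (simp add: t_def)
  have ux: "u x \<le> exp (\<sigma> * t) * u y"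
    using osc_cone_le[OF u, of n x y] xy unfolding st by simp
  have "v y \<le> exp (\<sigma> * t) * v x"
    using osc_cone_le[OF v, of n y x] xy unfolding st by simp
  then have vx: "exp (- (\<sigma> * t)) * v y \<le> v x"
    by (simp add: exp_minus field_simps)
  have gap: "\<kappa> * (exp t - exp (- (\<sigma> * t))) \<le> exp t - exp (\<sigma> * t)"
    using exp_gap_ratio[of \<sigma> t] par by (simp add: \<kappa>_def field_simps)
  have gap0: "0 \<le> exp t - exp (\<sigma> * t)"
    using par t mult_right_mono[of \<sigma> 1 t] by simp
  have "\<kappa> * s * (exp t * v y - v x) \<le> \<kappa> * s * ((exp t - exp (- (\<sigma> * t))) * v y)"
    using vx \<kappa> s by (intro mult_left_mono) (auto simp: left_diff_distrib)
  also have "\<dots> = \<kappa> * (exp t - exp (- (\<sigma> * t))) * (s * v y)"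
    by (simp add: mult_ac)
  also have "\<dots> \<le> (exp t - exp (\<sigma> * t)) * (s * v y)"
    using gap s osc_cone_nonneg[OF v] by (intro mult_right_mono) auto
  also have "\<dots> \<le> (exp t - exp (\<sigma> * t)) * u y"
    using gap0 le by (intro mult_left_mono)
  also have "\<dots> \<le> exp t * u y - u x"
    using ux by (simp add: left_diff_distrib)
  finally show "u x - (1 - \<sigma>) / (1 + \<sigma>) * s * v x
      \<le> exp (c * \<theta> ^ n) * (u y - (1 - \<sigma>) / (1 + \<sigma>) * s * v y)"
    unfolding \<kappa>_def[symmetric] t_def[symmetric] by (simp add: algebra_simps)
qed

text \<open>The Hilbert diameter of \<^term>\<open>osc_cone \<theta> (\<sigma> * c)\<close> inside \<^term>\<open>osc_cone \<theta> c\<close> is at most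
  \<^term>\<open>2 * ln q\<close>.\<close>

lemma osc_cone_comparable:
  assumes u: "u \<in> osc_cone \<theta> (\<sigma> * c)" and v: "v \<in> osc_cone \<theta> (\<sigma> * c)"
    and nz: "u x\<^sub>0 \<noteq> 0" "v x\<^sub>1 \<noteq> 0"
    and par: "0 \<le> \<sigma>" "\<sigma> < 1" "0 \<le> c" "0 \<le> \<theta>"
  defines "q \<equiv> exp (\<sigma> * c) * ((1 + \<sigma>) / (1 - \<sigma>))"
  shows "\<exists>a>0. (\<lambda>x. u x - a * v x) \<in> osc_cone \<theta> c \<and> (\<lambda>x. q\<^sup>2 * a * v x - u x) \<in> osc_cone \<theta> c"
proof -
  define E where "E = exp (\<sigma> * c)"
  have E: "E > 0"
    by (simp add: E_def)
  \<comment> \<open>Take \<open>m\<close> to be the infimum: the cone inequality at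
    \<open>n = 0\<close> bounds every value by \<open>E\<close> times it, and a single nonzero value
    forces it to be positive.\<close>
  have bounds: "\<exists>m>0. \<forall>x. m \<le> w x \<and> w x \<le> E * m"
    if w: "w \<in> osc_cone \<theta> (\<sigma> * c)" and "w z \<noteq> 0" for w :: "(nat \<Rightarrow> 'a) \<Rightarrow> real" and z
  proof (intro exI conjI allI)
    have bdd: "bdd_below (range w)"
      using osc_cone_nonneg[OF w] by (auto intro: bdd_belowI[of _ 0])
    show "Inf (range w) \<le> w x" for x
      using bdd by (rule cINF_lower) simp
    have "w x / E \<le> Inf (range w)" for x
      by (rule cINF_greatest) (use osc_cone_le0[OF w] E in \<open>auto simp: E_def field_simps\<close>)
    then show "w x \<le> E * Inf (range w)" for x
      using E by (simp add: field_simps)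
    from this[of z] have "0 < E * Inf (range w)"
      using that osc_cone_nonneg[OF w, of z] by linarith
    then show "0 < Inf (range w)"
      using E by (simp add: zero_less_mult_iff)
  qed
  obtain m where m: "m > 0" "\<And>x. m \<le> u x" "\<And>x. u x \<le> E * m"
    using bounds[OF u nz(1)] by blast
  obtain k where k: "k > 0" "\<And>x. k \<le> v x" "\<And>x. v x \<le> E * k"
    using bounds[OF v nz(2)] by blast
  define \<kappa> where "\<kappa> = (1 - \<sigma>) / (1 + \<sigma>)"
  have \<kappa>: "0 < \<kappa>"
    using par by (simp add: \<kappa>_def)
  have q: "q = E / \<kappa>"
    by (simp add: q_def E_def \<kappa>_def)
  \<comment> \<open>Chosen so that \<open>s * v \<le> m \<le> u\<close> and
    \<open>s' * u \<le> k \<le> v\<close>. Since \<open>s * s' = 1 / E\<^sup>2\<close> and each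
    comparison costs one factor \<open>\<kappa>\<close>, the two final constants are
    \<open>q\<^sup>2\<close> apart.\<close>
  define s s' where "s = m / (E * k)" and "s' = k / (E * m)"
  have s: "0 < s" "0 < s'"
    using m(1) k(1) E by (auto simp: s_def s'_def)
  have su: "s * v x \<le> u x" for x
  proof -
    have "s * v x \<le> s * (E * k)"
      using s k(3) by (intro mult_left_mono) auto
    also have "\<dots> = m"
      using E k(1) by (simp add: s_def)
    finally show ?thesis
      using m(2)[of x] by linarith
  qed
  have sv: "s' * u x \<le> v x" for x
  proof -
    have "s' * u x \<le> s' * (E * m)"
      using s m(3) by (intro mult_left_mono) auto
    also have "\<dots> = k"
      using E m(1) by (simp add: s'_def)
    finally show ?thesis
      using k(2)[of x] by linarith
  qed
  have 1: "(\<lambda>x. u x - \<kappa> * s * v x) \<in> osc_cone \<theta> c"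
    unfolding \<kappa>_def using s by (intro osc_cone_diff[OF u v su _ par]) auto
  have 2: "(\<lambda>x. v x - \<kappa> * s' * u x) \<in> osc_cone \<theta> c"
    unfolding \<kappa>_def using s by (intro osc_cone_diff[OF v u sv _ par]) auto
  have 3: "(\<lambda>x. 1 / (\<kappa> * s') * (v x - \<kappa> * s' * u x)) \<in> osc_cone \<theta> c"
    using \<kappa> s by (intro osc_cone_scale[OF 2]) auto
  have "1 / (\<kappa> * s') = q\<^sup>2 * (\<kappa> * s)"
    using \<kappa> E m(1) k(1) by (simp add: q s_def s'_def power2_eq_square)
  moreover have "1 / (\<kappa> * s') * (v x - \<kappa> * s' * u x) = 1 / (\<kappa> * s') * v x - u x" for x
    using \<kappa> s by (simp add: right_diff_distrib)
  ultimately have "(\<lambda>x. q\<^sup>2 * (\<kappa> * s) * v x - u x) \<in> osc_cone \<theta> c"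
    using 3 by simp
  then show ?thesis
    using 1 \<kappa> s by (intro exI[of _ "\<kappa> * s"]) auto
qed

section \<open>Birkhoff contraction\<close>

text \<open>Reduces to \<open>(1 - q * a)\<^sup>2 \<ge> 0\<close>, with equality at
  \<open>a = 1 / q\<close>. It frees the contraction factor from the comparison constant
  \<open>a\<close>, which varies from step to step.\<close>

lemma gap_quotient_bound:
  fixes a q :: real
  assumes "0 < a" "1 \<le> q"
  shows "(q\<^sup>2 * a - a) / ((1 + a) * (1 + q\<^sup>2 * a)) \<le> (q - 1) / (q + 1)"
proof -
  have pos: "0 < (1 + a) * (1 + q\<^sup>2 * a)"
    using assms by (simp add: add_pos_nonneg)
  have "(q + 1)\<^sup>2 * a \<le> (1 + a) * (1 + q\<^sup>2 * a)"
    using zero_le_power2[of "1 - q * a"] by (simp add: power2_eq_square algebra_simps)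
  then have "(q - 1) * ((q + 1)\<^sup>2 * a) \<le> (q - 1) * ((1 + a) * (1 + q\<^sup>2 * a))"
    using assms by (intro mult_left_mono) auto
  moreover have "(q\<^sup>2 * a - a) * (q + 1) = (q - 1) * ((q + 1)\<^sup>2 * a)"
    by (simp add: power2_eq_square algebra_simps)
  ultimately show ?thesis
    using pos assms by (simp add: divide_le_eq pos_le_divide_eq mult.commute)
qed

text \<open>Birkhoff's contraction in linear form: the gap \<^term>\<open>\<beta> - \<alpha>\<close> between the comparison
  constants contracts, rather than the Hilbert distance \<^term>\<open>ln (\<beta> / \<alpha>)\<close>, at the same rate.\<close>

lemma osc_cone_contraction:
  assumes lin: "\<And>f g s t. L (\<lambda>x. s * f x + t * g x) = (\<lambda>x. s * L f x + t * L g x)"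
    and maps: "L ` osc_cone \<theta> c \<subseteq> osc_cone \<theta> (\<sigma> * c)"
    and par: "0 \<le> \<sigma>" "\<sigma> < 1" "0 \<le> c" "0 \<le> \<theta>"
    and lo: "(\<lambda>x. f x - \<alpha> * g x) \<in> osc_cone \<theta> c"
    and up: "(\<lambda>x. \<beta> * g x - f x) \<in> osc_cone \<theta> c"
    and le: "\<alpha> \<le> \<beta>"
  defines "q \<equiv> exp (\<sigma> * c) * ((1 + \<sigma>) / (1 - \<sigma>))"
  shows "\<exists>\<alpha>' \<beta>'. \<alpha> \<le> \<alpha>' \<and> \<alpha>' \<le> \<beta>' \<and> \<beta>' \<le> \<beta> \<and> \<beta>' - \<alpha>' \<le> (q - 1) / (q + 1) * (\<beta> - \<alpha>) \<and>
    (\<lambda>x. L f x - \<alpha>' * L g x) \<in> osc_cone \<theta> c \<and> (\<lambda>x. \<beta>' * L g x - L f x) \<in> osc_cone \<theta> c"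
proof -
  have "1 \<le> exp (\<sigma> * c)" "1 \<le> (1 + \<sigma>) / (1 - \<sigma>)"
    using par by (auto simp: field_simps)
  then have q: "1 \<le> q"
    unfolding q_def using mult_mono[of 1 "exp (\<sigma> * c)" 1 "(1 + \<sigma>) / (1 - \<sigma>)"] by simp
  have rate: "0 \<le> (q - 1) / (q + 1) * (\<beta> - \<alpha>)"
    using q le by simp
  have Lu: "(\<lambda>x. L f x - \<alpha> * L g x) \<in> osc_cone \<theta> (\<sigma> * c)" (is "?u \<in> _")
    using subsetD[OF maps imageI[OF lo]] lin[of 1 f "- \<alpha>" g] by simp
  have Lv: "(\<lambda>x. \<beta> * L g x - L f x) \<in> osc_cone \<theta> (\<sigma> * c)" (is "?v \<in> _")
    using subsetD[OF maps imageI[OF up]] lin[of \<beta> g "- 1" f] by simp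
  \<comment> \<open>If one image vanishes, \<open>L f\<close> is an exact multiple of
    \<open>L g\<close> and both new constants can be taken equal; otherwise
    \<open>osc_cone_comparable\<close> applies.\<close>
  consider "\<And>x. ?u x = 0" | "\<And>x. ?v x = 0" | x\<^sub>0 x\<^sub>1 where "?u x\<^sub>0 \<noteq> 0" "?v x\<^sub>1 \<noteq> 0"
    by blast
  then show ?thesis
  proof cases
    case 1
    then have "L f x = \<alpha> * L g x" for x
      by simp
    then show ?thesis
      using le rate by (intro exI[of _ \<alpha>]) (auto simp: osc_cone_zero)
  next
    case 2
    then have "L f x = \<beta> * L g x" for x
      by simp
    then show ?thesis
      using le rate by (intro exI[of _ \<beta>]) (auto simp: osc_cone_zero)
  next
    case 3
    then obtain a where a: "a > 0" "(\<lambda>x. ?u x - a * ?v x) \<in> osc_cone \<theta> c"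
        "(\<lambda>x. q\<^sup>2 * a * ?v x - ?u x) \<in> osc_cone \<theta> c"
      using osc_cone_comparable[where u = ?u and v = ?v, OF Lu Lv 3 par] unfolding q_def[symmetric]
      by (elim exE conjE) (rule that)
    define b where "b = q\<^sup>2 * a"
    have "1 \<le> q\<^sup>2"
      using q by simp
    then have ab: "a \<le> b"
      using a(1) by (simp add: b_def)
    then have b: "b > 0"
      using a(1) by simp
    \<comment> \<open>Collecting terms, \<open>?u - a * ?v\<close> is
      \<open>(1 + a) * L f - (\<alpha> + a * \<beta>) * L g\<close>, and \<open>b * ?v - ?u\<close>
      is \<open>(\<alpha> + b * \<beta>) * L g - (1 + b) * L f\<close>; normalising the coefficient
      of \<open>L f\<close> gives these weighted means of \<open>\<alpha>\<close> and
      \<open>\<beta>\<close>.\<close>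
    define \<alpha>' \<beta>' where "\<alpha>' = (\<alpha> + a * \<beta>) / (1 + a)" and "\<beta>' = (\<alpha> + b * \<beta>) / (1 + b)"
    have gap: "\<beta>' - \<alpha>' = (b - a) / ((1 + a) * (1 + b)) * (\<beta> - \<alpha>)"
      using a(1) b by (simp add: \<alpha>'_def \<beta>'_def field_simps)
    have "(b - a) / ((1 + a) * (1 + b)) * (\<beta> - \<alpha>) \<le> (q - 1) / (q + 1) * (\<beta> - \<alpha>)"
      using gap_quotient_bound[OF a(1) q] le unfolding b_def by (intro mult_right_mono) auto
    then have c1: "\<beta>' - \<alpha>' \<le> (q - 1) / (q + 1) * (\<beta> - \<alpha>)"
      using gap by simp
    have "0 \<le> (b - a) / ((1 + a) * (1 + b)) * (\<beta> - \<alpha>)"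
      using a(1) b ab le by simp
    then have c2: "\<alpha>' \<le> \<beta>'"
      using gap by simp
    have c3: "\<alpha> \<le> \<alpha>'" "\<beta>' \<le> \<beta>"
      using a(1) b le by (auto simp: \<alpha>'_def \<beta>'_def field_simps)
    have "(\<lambda>x. 1 / (1 + a) * (?u x - a * ?v x)) \<in> osc_cone \<theta> c"
      using a(1) by (intro osc_cone_scale[OF a(2)]) auto
    moreover have "1 / (1 + a) * (?u x - a * ?v x) = L f x - \<alpha>' * L g x" for x
      using a(1) by (simp add: \<alpha>'_def field_simps)
    ultimately have c4: "(\<lambda>x. L f x - \<alpha>' * L g x) \<in> osc_cone \<theta> c"
      by simp
    have "(\<lambda>x. 1 / (1 + b) * (b * ?v x - ?u x)) \<in> osc_cone \<theta> c"
      using b a(3) unfolding b_def[symmetric] by (intro osc_cone_scale) auto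
    moreover have "1 / (1 + b) * (b * ?v x - ?u x) = \<beta>' * L g x - L f x" for x
      using b by (simp add: \<beta>'_def field_simps)
    ultimately have c5: "(\<lambda>x. \<beta>' * L g x - L f x) \<in> osc_cone \<theta> c"
      by simp
    show ?thesis
      by (intro exI[of _ \<alpha>'] exI[of _ \<beta>'] conjI c1 c2 c3 c4 c5)
  qed
qed

section \<open>Transfer operators over the fibres of a one-block map\<close>

definition transfer ::
    "((nat \<Rightarrow> 'a) \<Rightarrow> real) \<Rightarrow> ('a \<Rightarrow> 'b) \<Rightarrow> 'b \<Rightarrow> ((nat \<Rightarrow> 'a) \<Rightarrow> real) \<Rightarrow> (nat \<Rightarrow> 'a) \<Rightarrow> real" where
  "transfer \<phi> p b f x = (\<Sum>a | p a = b. exp (\<phi> (case_nat a x)) * f (case_nat a x))"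

text \<open>The operator of the last letter is outermost, since that letter is adjacent to the tail
  \<open>x\<close>. Hence the products for \<open>y\<close> and \<open>left_shift y\<close> differ
  only in the innermost operator, that of \<open>y 0\<close>.\<close>

fun partition_fun ::
    "((nat \<Rightarrow> 'a) \<Rightarrow> real) \<Rightarrow> ('a \<Rightarrow> 'b) \<Rightarrow> nat \<Rightarrow> (nat \<Rightarrow> 'b) \<Rightarrow> (nat \<Rightarrow> 'a) \<Rightarrow> real" where
  "partition_fun \<phi> p 0 y = (\<lambda>x. 1)"
| "partition_fun \<phi> p (Suc n) y = transfer \<phi> p (y n) (partition_fun \<phi> p n y)"

lemma transfer_linear:
  "transfer \<phi> p b (\<lambda>x. s * f x + t * g x) = (\<lambda>x. s * transfer \<phi> p b f x + t * transfer \<phi> p b g x)"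
  by (auto simp: transfer_def sum_distrib_left sum.distrib[symmetric] algebra_simps intro!: sum.cong)

lemma transfer_pos:
  fixes p :: "'a::finite \<Rightarrow> 'b"
  assumes "b \<in> range p" "\<And>x. 0 < f x"
  shows "0 < transfer \<phi> p b f x"
  unfolding transfer_def using assms by (intro sum_pos) auto

lemma partition_fun_pos:
  fixes p :: "'a::finite \<Rightarrow> 'b"
  assumes "y \<in> range (block_map p)"
  shows "0 < partition_fun \<phi> p n y x"
proof (induction n arbitrary: x)
  case (Suc n)
  have "y n \<in> range p"
    using assms by (auto simp: block_map_def)
  then show ?case
    using transfer_pos[of "y n" p "partition_fun \<phi> p n y"] Suc by simp
qed simp

lemma partition_fun_cong:
  "(\<And>i. i < n \<Longrightarrow> y i = y' i) \<Longrightarrow> partition_fun \<phi> p n y = partition_fun \<phi> p n y'"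
  by (induction n) auto

section \<open>Partition functions as sums over words in the fibre\<close>

lemma left_shift_funpow: "(left_shift ^^ n) x = (\<lambda>i. x (n + i))"
  by (induction n) (auto simp: left_shift_def)

text \<open>Words of length \<open>n\<close> are encoded as full sequences with the prescribed tail
  \<open>x\<close>, so that Birkhoff sums of \<open>\<phi>\<close> can be evaluated on them.\<close>

definition fibre_words :: "('a \<Rightarrow> 'b) \<Rightarrow> nat \<Rightarrow> (nat \<Rightarrow> 'b) \<Rightarrow> (nat \<Rightarrow> 'a) \<Rightarrow> (nat \<Rightarrow> 'a) set" where
  "fibre_words p n y x = {z. (left_shift ^^ n) z = x \<and> (\<forall>i<n. p (z i) = y i)}"

lemma fibre_words_0: "fibre_words p 0 y x = {x}"
  by (auto simp: fibre_words_def)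

text \<open>The letter split off is \<open>z n\<close>, the one next to the tail, to match the
  recursion of \<open>partition_fun\<close>.\<close>

lemma fibre_words_Suc:
  "fibre_words p (Suc n) y x = (\<Union>a\<in>{a. p a = y n}. fibre_words p n y (case_nat a x))"
proof (rule set_eqI)
  fix z
  have shift: "(left_shift ^^ Suc n) z = x \<longleftrightarrow> (left_shift ^^ n) z = case_nat (z n) x"
    unfolding left_shift_funpow fun_eq_iff by (auto split: nat.split)
  have "z n = a" if "(left_shift ^^ n) z = case_nat a x" for a
    using fun_cong[OF that, of 0] by (simp add: left_shift_funpow)
  then have "z \<in> (\<Union>a\<in>{a. p a = y n}. fibre_words p n y (case_nat a x)) \<longleftrightarrow>
      p (z n) = y n \<and> z \<in> fibre_words p n y (case_nat (z n) x)"
    unfolding fibre_words_def by blast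
  then show "z \<in> fibre_words p (Suc n) y x \<longleftrightarrow>
      z \<in> (\<Union>a\<in>{a. p a = y n}. fibre_words p n y (case_nat a x))"
    unfolding fibre_words_def mem_Collect_eq shift less_Suc_eq by blast
qed

lemma finite_fibre_words: "finite (fibre_words p n y (x :: nat \<Rightarrow> 'a::finite))"
  by (induction n arbitrary: x) (auto simp: fibre_words_0 fibre_words_Suc)

lemma partition_fun_eq_sum:
  fixes \<phi> :: "(nat \<Rightarrow> 'a::finite) \<Rightarrow> real"
  shows "partition_fun \<phi> p n y x =
    (\<Sum>z\<in>fibre_words p n y x. exp (\<Sum>k<n. \<phi> ((left_shift ^^ k) z)))"
proof (induction n arbitrary: x)
  case (Suc n)
  have last: "z \<in> fibre_words p n y (case_nat a x) \<Longrightarrow> (left_shift ^^ n) z = case_nat a x" for z a x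
    by (simp add: fibre_words_def)
  have head: "z \<in> fibre_words p n y (case_nat a x) \<Longrightarrow> z n = a" for z a x
    using fun_cong[OF last, of z a x 0] by (simp add: left_shift_funpow)
  have "partition_fun \<phi> p (Suc n) y x =
      (\<Sum>a | p a = y n. \<Sum>z\<in>fibre_words p n y (case_nat a x).
        exp (\<phi> (case_nat a x)) * exp (\<Sum>k<n. \<phi> ((left_shift ^^ k) z)))"
    by (simp add: transfer_def Suc sum_distrib_left)
  also have "\<dots> = (\<Sum>a | p a = y n. \<Sum>z\<in>fibre_words p n y (case_nat a x).
        exp (\<Sum>k<Suc n. \<phi> ((left_shift ^^ k) z)))"
    by (intro sum.cong refl) (simp add: last exp_add)
  also have "\<dots> = (\<Sum>z\<in>fibre_words p (Suc n) y x. exp (\<Sum>k<Suc n. \<phi> ((left_shift ^^ k) z)))"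
    unfolding fibre_words_Suc
    by (subst sum.UNION_disjoint) (auto dest: head simp: finite_fibre_words simp del: sum.lessThan_Suc)
  finally show ?case .
qed (simp add: fibre_words_0)

section \<open>Contraction rate and the projected potential\<close>

text \<open>The variation bound starts at one common letter: two points \<open>case_nat a x\<close>
  and \<open>case_nat a y\<close> compared in a transfer operator always share their first
  letter.\<close>

locale fibred_potential =
  fixes \<phi> :: "(nat \<Rightarrow> 'a::finite) \<Rightarrow> real" and p :: "'a \<Rightarrow> 'b::finite" and \<theta> \<sigma> K :: real
  assumes \<theta>_pos: "0 < \<theta>" and \<theta>_less: "\<theta> < \<sigma>" and \<sigma>_less: "\<sigma> < 1" and K_nonneg: "0 \<le> K"
    and variation: "\<And>n x y. (\<And>i. i < Suc n \<Longrightarrow> x i = y i) \<Longrightarrow> \<bar>\<phi> x - \<phi> y\<bar> \<le> K * \<theta> ^ Suc n"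
begin

text \<open>The number \<open>c\<close> is the solution of \<open>\<theta> * (K + c) = \<sigma> * c\<close>, so that transfer operators map
  \<^term>\<open>osc_cone \<theta> c\<close> into \<^term>\<open>osc_cone \<theta> (\<sigma> * c)\<close>.\<close>

definition c :: real where "c = K * \<theta> / (\<sigma> - \<theta>)"

definition q :: real where "q = exp (\<sigma> * c) * ((1 + \<sigma>) / (1 - \<sigma>))"

text \<open>With \<Delta> = \<open>2 * ln q\<close> as bound for the Hilbert diameter, this is tanh
  (\<Delta> / 4), Birkhoff's contraction coefficient.\<close>

definition rate :: real where "rate = (q - 1) / (q + 1)"

lemma c_nonneg: "0 \<le> c"
  using \<theta>_pos \<theta>_less K_nonneg by (simp add: c_def)

lemma c_eq: "\<theta> * (K + c) = \<sigma> * c"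
  using \<theta>_less by (simp add: c_def field_simps)

lemma q_gt_1: "1 < q"
proof -
  have "1 < (1 + \<sigma>) / (1 - \<sigma>)" "1 \<le> exp (\<sigma> * c)"
    using \<theta>_pos \<theta>_less \<sigma>_less c_nonneg by (auto simp: field_simps)
  then show ?thesis
    unfolding q_def using mult_right_mono[of 1 "exp (\<sigma> * c)" "(1 + \<sigma>) / (1 - \<sigma>)"] by linarith
qed

lemma rate_bounds: "0 < rate" "rate < 1"
  using q_gt_1 by (auto simp: rate_def field_simps)

lemma rate_eq_tanh:
  "rate = tanh (1/2 * (ln ((1 + \<sigma>) / (1 - \<sigma>)) + \<sigma> * (K * \<theta> / (\<sigma> - \<theta>))))"
proof -
  have "0 < (1 + \<sigma>) / (1 - \<sigma>)"
    using \<theta>_pos \<theta>_less \<sigma>_less by simp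
  then have "ln q = ln ((1 + \<sigma>) / (1 - \<sigma>)) + \<sigma> * c"
    unfolding q_def by (simp only: ln_mult_pos exp_gt_zero ln_exp)
  moreover have "tanh (1/2 * ln q) = (1 - 1 / q) / (1 + 1 / q)"
    using q_gt_1 unfolding tanh_real_altdef by (simp add: exp_minus inverse_eq_divide)
  moreover have "1 - 1 / q = (q - 1) / q" "1 + 1 / q = (q + 1) / q"
    using q_gt_1 by (simp_all add: field_simps)
  ultimately show ?thesis
    using q_gt_1 by (simp add: rate_def c_def)
qed

text \<open>Prepending a common letter turns agreement on \<open>n\<close> letters into agreement on
  \<open>Suc n\<close>. The potential then contributes \<open>K\<close> and the function
  \<open>c\<close> to the exponent, both with an extra factor \<open>\<theta>\<close>, and
  \<open>c_eq\<close> turns the total into \<open>\<sigma> * c\<close>.\<close>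

lemma transfer_osc_cone:
  assumes f: "f \<in> osc_cone \<theta> c"
  shows "transfer \<phi> p b f \<in> osc_cone \<theta> (\<sigma> * c)"
proof (rule osc_coneI)
  show "0 \<le> transfer \<phi> p b f x" for x
    unfolding transfer_def by (intro sum_nonneg mult_nonneg_nonneg osc_cone_nonneg[OF f]) auto
  fix n and x y :: "nat \<Rightarrow> 'a"
  assume xy: "\<And>i. i < n \<Longrightarrow> x i = y i"
  show "transfer \<phi> p b f x \<le> exp (\<sigma> * c * \<theta> ^ n) * transfer \<phi> p b f y"
    unfolding transfer_def sum_distrib_left
  proof (rule sum_mono)
    fix a
    let ?x = "case_nat a x" and ?y = "case_nat a y"
    have eq: "?x i = ?y i" if "i < Suc n" for i
      using that xy by (auto split: nat.split)
    have "\<phi> ?x \<le> K * \<theta> ^ Suc n + \<phi> ?y"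
      using variation[of n ?x ?y, OF eq] by linarith
    then have "exp (\<phi> ?x) * f ?x \<le> exp (K * \<theta> ^ Suc n + \<phi> ?y) * (exp (c * \<theta> ^ Suc n) * f ?y)"
      using osc_cone_le[OF f, of "Suc n" ?x ?y, OF eq] osc_cone_nonneg[OF f]
      by (intro mult_mono) auto
    also have "\<dots> = exp (K * \<theta> ^ Suc n + c * \<theta> ^ Suc n) * (exp (\<phi> ?y) * f ?y)"
      by (simp add: exp_add)
    also have "K * \<theta> ^ Suc n + c * \<theta> ^ Suc n = \<theta> * (K + c) * \<theta> ^ n"
      by (simp add: algebra_simps)
    finally show "exp (\<phi> ?x) * f ?x \<le> exp (\<sigma> * c * \<theta> ^ n) * (exp (\<phi> ?y) * f ?y)"
      unfolding c_eq .
  qed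
qed

text \<open>Numerator and denominator arise from
  \<open>transfer \<phi> p (y 0) (\<lambda>x. 1)\<close> and the constant 1 by applying the same
  operators, those of \<open>y 1\<close>, ..., \<open>y n\<close>. The constants bracketing their
  quotient are nested and their gap shrinks by \<open>rate\<close> at each step; since they hold for
  all \<open>x\<close>, the limit does not depend on the tail.\<close>

lemma ratio_limit:
  assumes y: "y \<in> range (block_map p)"
  shows "\<exists>l. \<forall>n x. \<bar>ln (partition_fun \<phi> p (Suc n) y x / partition_fun \<phi> p n (left_shift y) x) - l\<bar>
    \<le> (q\<^sup>2 - 1) * rate ^ n"
proof -
  let ?f = "\<lambda>n. partition_fun \<phi> p (Suc n) y" and ?g = "\<lambda>n. partition_fun \<phi> p n (left_shift y)"
  have \<sigma>: "0 \<le> \<sigma>" "0 \<le> \<theta>"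
    using \<theta>_pos \<theta>_less by auto
  have sy: "left_shift y \<in> range (block_map p)"
    using y by (auto simp: left_shift_def block_map_def)
  have fpos: "0 < ?f n x" and gpos: "0 < ?g n x" for n x
    using partition_fun_pos[OF y, of \<phi> "Suc n" x] partition_fun_pos[OF sy] by auto
  define compar where "compar n \<alpha> \<beta> \<longleftrightarrow> \<alpha> \<le> \<beta> \<and> (\<lambda>x. ?f n x - \<alpha> * ?g n x) \<in> osc_cone \<theta> c \<and>
    (\<lambda>x. \<beta> * ?g n x - ?f n x) \<in> osc_cone \<theta> c" for n \<alpha> \<beta>
  have f0: "?f 0 \<in> osc_cone \<theta> (\<sigma> * c)"
    using transfer_osc_cone[OF osc_cone_one, OF c_nonneg \<sigma>(2)] by simp
  have g0: "?g 0 \<in> osc_cone \<theta> (\<sigma> * c)"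
    using osc_cone_one[of "\<sigma> * c" \<theta>] c_nonneg \<sigma> by simp
  obtain a where a: "a > 0" "(\<lambda>x. ?f 0 x - a * ?g 0 x) \<in> osc_cone \<theta> c"
      "(\<lambda>x. q\<^sup>2 * a * ?g 0 x - ?f 0 x) \<in> osc_cone \<theta> c"
    using osc_cone_comparable[where u = "?f 0" and v = "?g 0", OF f0 g0 less_imp_neq[OF fpos, symmetric]
        less_imp_neq[OF gpos, symmetric] \<sigma>(1) \<sigma>_less c_nonneg \<sigma>(2)]
    unfolding q_def[symmetric] by (elim exE conjE) (rule that)
  have "1 \<le> q\<^sup>2"
    using q_gt_1 by simp
  then have start: "compar 0 a (q\<^sup>2 * a)"
    unfolding compar_def using a by simp
  have step: "\<exists>\<alpha>' \<beta>'. compar (Suc n) \<alpha>' \<beta>' \<and> \<alpha> \<le> \<alpha>' \<and> \<beta>' \<le> \<beta> \<and> \<beta>' - \<alpha>' \<le> rate * (\<beta> - \<alpha>)"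
    if "compar n \<alpha> \<beta>" for n \<alpha> \<beta>
  proof -
    have 1: "transfer \<phi> p (y (Suc n)) (?f n) = ?f (Suc n)"
      by simp
    have 2: "transfer \<phi> p (y (Suc n)) (?g n) = ?g (Suc n)"
      by (simp add: left_shift_def)
    have maps: "transfer \<phi> p (y (Suc n)) ` osc_cone \<theta> c \<subseteq> osc_cone \<theta> (\<sigma> * c)"
      using transfer_osc_cone by blast
    have 3: "\<alpha> \<le> \<beta>" "(\<lambda>x. ?f n x - \<alpha> * ?g n x) \<in> osc_cone \<theta> c"
        "(\<lambda>x. \<beta> * ?g n x - ?f n x) \<in> osc_cone \<theta> c"
      using that by (simp_all only: compar_def)
    show ?thesis
      using osc_cone_contraction[where L = "transfer \<phi> p (y (Suc n))" and f = "?f n" and g = "?g n",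
          OF transfer_linear maps \<sigma>(1) \<sigma>_less c_nonneg \<sigma>(2) 3(2,3,1)]
      unfolding 1 2 q_def[symmetric] rate_def[symmetric] compar_def
      by (elim exE conjE) (intro exI conjI; assumption)
  qed
  obtain \<gamma> where \<gamma>0: "fst (\<gamma> 0) = a" "snd (\<gamma> 0) = q\<^sup>2 * a"
    and compar: "\<And>n. compar n (fst (\<gamma> n)) (snd (\<gamma> n))"
    and nested: "\<And>n. fst (\<gamma> n) \<le> fst (\<gamma> (Suc n))" "\<And>n. snd (\<gamma> (Suc n)) \<le> snd (\<gamma> n)"
    and shrink: "\<And>n. snd (\<gamma> (Suc n)) - fst (\<gamma> (Suc n)) \<le> rate * (snd (\<gamma> n) - fst (\<gamma> n))"
  proof -
    \<comment> \<open>The clause for \<open>n = 0\<close> pins the first bracket to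
      \<open>(a, q\<^sup>2 * a)\<close>, from which the size of all later gaps is computed.\<close>
    have "\<exists>\<gamma>. \<forall>n. (compar n (fst (\<gamma> n)) (snd (\<gamma> n)) \<and> (n = 0 \<longrightarrow> \<gamma> n = (a, q\<^sup>2 * a))) \<and>
        (fst (\<gamma> n) \<le> fst (\<gamma> (Suc n)) \<and> snd (\<gamma> (Suc n)) \<le> snd (\<gamma> n) \<and>
         snd (\<gamma> (Suc n)) - fst (\<gamma> (Suc n)) \<le> rate * (snd (\<gamma> n) - fst (\<gamma> n)))"
    proof (rule dependent_nat_choice)
      show "\<exists>z. compar 0 (fst z) (snd z) \<and> (0 = (0::nat) \<longrightarrow> z = (a, q\<^sup>2 * a))"
        using start by auto
      show "\<exists>z'. (compar (Suc n) (fst z') (snd z') \<and> (Suc n = 0 \<longrightarrow> z' = (a, q\<^sup>2 * a))) \<and>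
          fst z \<le> fst z' \<and> snd z' \<le> snd z \<and> snd z' - fst z' \<le> rate * (snd z - fst z)"
        if "compar n (fst z) (snd z) \<and> (n = 0 \<longrightarrow> z = (a, q\<^sup>2 * a))" for n z
        using step[of n "fst z" "snd z"] that by auto
    qed
    then show thesis
      using that by (metis fst_conv snd_conv)
  qed
  define \<alpha> \<beta> where "\<alpha> n = fst (\<gamma> n)" and "\<beta> n = snd (\<gamma> n)" for n
  have inc: "incseq \<alpha>" and dec: "decseq \<beta>"
    unfolding \<alpha>_def \<beta>_def using nested by (auto intro: incseq_SucI decseq_SucI)
  have le: "\<alpha> n \<le> \<beta> n" for n
    using compar[of n] by (simp add: compar_def \<alpha>_def \<beta>_def)
  have \<alpha>a: "a \<le> \<alpha> n" for n
    using incseqD[OF inc, of 0 n] \<gamma>0 by (simp add: \<alpha>_def)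
  have cross: "\<alpha> m \<le> \<beta> n" for m n
    using incseqD[OF inc, of m "max m n"] le[of "max m n"] decseqD[OF dec, of n "max m n"] by simp
  define L where "L = (SUP n. \<alpha> n)"
  have "bdd_above (range \<alpha>)"
    using cross[of _ 0] by (auto intro: bdd_aboveI[of _ "\<beta> 0"])
  then have \<alpha>L: "\<alpha> n \<le> L" for n
    unfolding L_def by (rule cSUP_upper[rotated]) simp
  have L\<beta>: "L \<le> \<beta> n" for n
    unfolding L_def by (rule cSUP_least) (auto intro: cross)
  have gap: "\<beta> n - \<alpha> n \<le> rate ^ n * (q\<^sup>2 * a - a)" for n
  proof (induction n)
    case (Suc n)
    have "\<beta> (Suc n) - \<alpha> (Suc n) \<le> rate * (\<beta> n - \<alpha> n)"
      unfolding \<alpha>_def \<beta>_def by (rule shrink)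
    also have "\<dots> \<le> rate * (rate ^ n * (q\<^sup>2 * a - a))"
      using Suc rate_bounds by (intro mult_left_mono) auto
    finally show ?case
      by (simp add: mult.assoc)
  qed (simp add: \<alpha>_def \<beta>_def \<gamma>0)
  show ?thesis
  proof (intro exI[of _ "ln L"] allI)
    fix n x
    have \<alpha>pos: "0 < \<alpha> n"
      using \<alpha>a[of n] a(1) by linarith
    have "0 \<le> ?f n x - \<alpha> n * ?g n x" "0 \<le> \<beta> n * ?g n x - ?f n x"
      using compar[of n] osc_cone_nonneg unfolding compar_def \<alpha>_def \<beta>_def by blast+
    then have R: "\<alpha> n \<le> ?f n x / ?g n x" "?f n x / ?g n x \<le> \<beta> n"
      using gpos[of n x] by (auto simp: field_simps)
    have "ln (\<alpha> n) \<le> ln (?f n x / ?g n x)" "ln (?f n x / ?g n x) \<le> ln (\<beta> n)"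
      "ln (\<alpha> n) \<le> ln L" "ln L \<le> ln (\<beta> n)"
      using R \<alpha>pos \<alpha>L[of n] L\<beta>[of n] by (subst ln_le_cancel_iff; linarith)+
    then have "\<bar>ln (?f n x / ?g n x) - ln L\<bar> \<le> ln (\<beta> n) - ln (\<alpha> n)"
      by linarith
    \<comment> \<open>From here the aim is a constant independent of \<open>y\<close>:
      \<open>\<alpha> n \<ge> a\<close>, and \<open>a\<close> cancels against the initial gap
      \<open>q\<^sup>2 * a - a\<close>.\<close>
    also have "\<dots> \<le> (\<beta> n - \<alpha> n) / \<alpha> n"
      using ln_diff_le[of "\<beta> n" "\<alpha> n"] \<alpha>pos le[of n] by linarith
    also have "\<dots> \<le> (\<beta> n - \<alpha> n) / a"
      using a(1) \<alpha>a[of n] le[of n] by (intro divide_left_mono) auto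
    also have "\<dots> \<le> rate ^ n * (q\<^sup>2 * a - a) / a"
      using gap[of n] a(1) by (intro divide_right_mono) auto
    also have "\<dots> = (q\<^sup>2 - 1) * rate ^ n"
      using a(1) by (simp add: field_simps)
    finally show "\<bar>ln (?f n x / ?g n x) - ln L\<bar> \<le> (q\<^sup>2 - 1) * rate ^ n" .
  qed
qed

text \<open>\<open>\<psi> y\<close> is the limit of the log quotients. The uniform error in
  \<open>ratio_limit\<close> gives both the variation bound and, summed along the orbit, a bounded
  distance between ln of the partition function and the Birkhoff sum of
  \<open>\<psi>\<close>.\<close>

lemma projected_potential:
  obtains \<psi> B where
    "\<And>n y y'. y \<in> range (block_map p) \<Longrightarrow> y' \<in> range (block_map p) \<Longrightarrow> n \<ge> 1 \<Longrightarrow>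
      (\<And>i. i < n \<Longrightarrow> y i = y' i) \<Longrightarrow> \<bar>\<psi> y - \<psi> y'\<bar> \<le> B * rate ^ n"
    and "\<And>n y x. y \<in> range (block_map p) \<Longrightarrow>
      \<bar>ln (partition_fun \<phi> p n y x) - (\<Sum>k<n. \<psi> ((left_shift ^^ k) y))\<bar> \<le> B"
proof -
  let ?R = "\<lambda>n y x. ln (partition_fun \<phi> p (Suc n) y x / partition_fun \<phi> p n (left_shift y) x)"
  define D where "D = q\<^sup>2 - 1"
  have D: "0 \<le> D"
    using q_gt_1 by (simp add: D_def)
  obtain \<psi> where \<psi>: "\<And>y n x. y \<in> range (block_map p) \<Longrightarrow> \<bar>?R n y x - \<psi> y\<bar> \<le> D * rate ^ n"
    using ratio_limit unfolding D_def by metis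
  \<comment> \<open>The first entry absorbs the index shift from \<open>rate ^ (n - 1)\<close> to
    \<open>rate ^ n\<close> and the factor 2 of a triangle inequality; the second is the sum of the
    geometric series.\<close>
  define B where "B = max (2 * D / rate) (D / (1 - rate))"
  show thesis
  proof (rule that[of \<psi> B])
    fix n and y y' :: "nat \<Rightarrow> 'b"
    assume yy': "y \<in> range (block_map p)" "y' \<in> range (block_map p)" "n \<ge> 1"
      and eq: "\<And>i. i < n \<Longrightarrow> y i = y' i"
    obtain m where m: "n = Suc m"
      using yy'(3) by (cases n) auto
    have "partition_fun \<phi> p (Suc m) y = partition_fun \<phi> p (Suc m) y'"
      using eq unfolding m by (rule partition_fun_cong)
    moreover have "partition_fun \<phi> p m (left_shift y) = partition_fun \<phi> p m (left_shift y')"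
      using eq unfolding m by (intro partition_fun_cong) (simp add: left_shift_def)
    ultimately have "?R m y = ?R m y'"
      by simp
    \<comment> \<open>The \<open>m\<close>-th quotient reads only the first \<open>Suc m = n\<close>
      letters, so both values of \<open>\<psi>\<close> are close to the same number; the tail
      \<open>undefined\<close> is an arbitrary choice.\<close>
    then have "\<bar>\<psi> y - \<psi> y'\<bar> \<le> 2 * (D * rate ^ m)"
      using \<psi>[OF yy'(1), of m undefined] \<psi>[OF yy'(2), of m undefined] by (simp add: fun_eq_iff)
    also have "\<dots> = 2 * D / rate * rate ^ n"
      using rate_bounds by (simp add: m)
    also have "\<dots> \<le> B * rate ^ n"
      using rate_bounds by (intro mult_right_mono) (auto simp: B_def)
    finally show "\<bar>\<psi> y - \<psi> y'\<bar> \<le> B * rate ^ n" .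
  next
    fix n x and y :: "nat \<Rightarrow> 'b"
    assume y: "y \<in> range (block_map p)"
    have "\<bar>ln (partition_fun \<phi> p n y x) - (\<Sum>k<n. \<psi> ((left_shift ^^ k) y))\<bar>
        \<le> (\<Sum>k<n. D * rate ^ k)"
      using y
    proof (induction n arbitrary: y)
      case (Suc n)
      have sy: "left_shift y \<in> range (block_map p)"
        using Suc.prems by (auto simp: left_shift_def block_map_def)
      \<comment> \<open>Telescoping: passing from \<open>y\<close> to \<open>left_shift y\<close>
        and from \<open>Suc n\<close> to \<open>n\<close> costs \<open>\<psi> y\<close> up to
        \<open>D * rate ^ n\<close>.\<close>
      have "?R n y x = ln (partition_fun \<phi> p (Suc n) y x) - ln (partition_fun \<phi> p n (left_shift y) x)"
        using partition_fun_pos[OF Suc.prems, of \<phi> "Suc n" x] partition_fun_pos[OF sy, of \<phi> n x]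
        by (intro ln_divide_pos) auto
      moreover have "(\<Sum>k<Suc n. \<psi> ((left_shift ^^ k) y))
          = \<psi> y + (\<Sum>k<n. \<psi> ((left_shift ^^ k) (left_shift y)))"
        by (subst sum.lessThan_Suc_shift) (simp add: funpow_swap1)
      ultimately show ?case
        using \<psi>[OF Suc.prems, of n x] Suc.IH[OF sy] by simp
    qed simp
    also have "\<dots> \<le> D * (1 / (1 - rate))"
      unfolding sum_distrib_left[symmetric]
      using rate_bounds D sum_le_suminf[of "\<lambda>k. rate ^ k" "{..<n}"]
      by (intro mult_left_mono) (auto simp: suminf_geometric summable_geometric)
    also have "\<dots> \<le> B"
      by (simp add: B_def)
    finally show "\<bar>ln (partition_fun \<phi> p n y x) - (\<Sum>k<n. \<psi> ((left_shift ^^ k) y))\<bar> \<le> B" .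
  qed
qed

end

section \<open>Cylinders and measurability\<close>

lemma topspace_shift_topology [simp]: "topspace (shift_topology X) = X"
  by (simp add: shift_topology_def)

lemma space_shift_borel [simp]: "space (shift_borel X) = X"
  unfolding shift_borel_def using openin_subset by (intro space_measure_of) fastforce

lemma sets_shift_borel:
  "sets (shift_borel X) = sigma_sets X {U. openin (shift_topology X) U}"
  unfolding shift_borel_def using openin_subset by (intro sets_measure_of) fastforce

lemma continuous_map_coordinate:
  "continuous_map (shift_topology X) (discrete_topology UNIV) (\<lambda>x. x i)"
  unfolding shift_topology_def
  by (rule continuous_map_from_subtopology[OF continuous_map_product_projection]) simp

lemma measurable_shift_borel:
  assumes "continuous_map (shift_topology X) (shift_topology Y) f"
  shows "f \<in> shift_borel X \<rightarrow>\<^sub>M shift_borel Y"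
  unfolding shift_borel_def[of Y]
proof (rule measurable_measure_of)
  show "f \<in> space (shift_borel X) \<rightarrow> Y"
    using assms continuous_map_image_subset_topspace by fastforce
  fix U
  assume "U \<in> {U. openin (shift_topology Y) U}"
  then have "openin (shift_topology X) {x \<in> X. f x \<in> U}"
    using openin_continuous_map_preimage[OF assms] by simp
  moreover have "f -` U \<inter> space (shift_borel X) = {x \<in> X. f x \<in> U}"
    by auto
  ultimately show "f -` U \<inter> space (shift_borel X) \<in> sets (shift_borel X)"
    by (auto simp: sets_shift_borel)
qed (use openin_subset in fastforce)

lemma measurable_left_shift:
  assumes "\<And>x. x \<in> X \<Longrightarrow> left_shift x \<in> X"
  shows "left_shift \<in> shift_borel X \<rightarrow>\<^sub>M shift_borel X"
proof (rule measurable_shift_borel)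
  show "continuous_map (shift_topology X) (shift_topology X) left_shift"
    unfolding shift_topology_def[of X] continuous_map_in_subtopology continuous_map_componentwise_UNIV
    unfolding shift_topology_def[of X, symmetric]
    using assms by (auto simp: left_shift_def continuous_map_coordinate)
qed

lemma measurable_block_map:
  "block_map p \<in> shift_borel UNIV \<rightarrow>\<^sub>M shift_borel (range (block_map p))"
proof (rule measurable_shift_borel)
  have "continuous_map (shift_topology UNIV) (discrete_topology UNIV) (\<lambda>x. p (x i))" for i
    using continuous_map_compose[OF continuous_map_coordinate,
        of "discrete_topology UNIV" p UNIV i]
    by (simp add: o_def)
  then show "continuous_map (shift_topology UNIV) (shift_topology (range (block_map p))) (block_map p)"
    unfolding shift_topology_def[of "range _"] continuous_map_in_subtopology
      continuous_map_componentwise_UNIV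
    by (auto simp: block_map_def)
qed

lemma cylinder_sets: "cylinder X n x \<in> sets (shift_borel X)"
proof -
  have "openin (shift_topology X) (X \<inter> (\<Inter>i\<in>{..<n}. {y \<in> X. y i = x i}))"
  \<comment> \<open>An intersection over no indices is the whole type, so the empty word is treated
    separately.\<close>
  proof (cases "n = 0")
    case True
    then show ?thesis
      using openin_topspace[of "shift_topology X"] by simp
  next
    case False
    have "openin (shift_topology X) {y \<in> X. y i = x i}" for i
      using openin_continuous_map_preimage[OF continuous_map_coordinate, of "{x i}" X i] by simp
    then have "openin (shift_topology X) (\<Inter>i\<in>{..<n}. {y \<in> X. y i = x i})"
      using False by (intro openin_INT2) auto
    then show ?thesis
      using openin_topspace[of "shift_topology X"] by (intro openin_Int) auto
  qed
  moreover have "cylinder X n x = X \<inter> (\<Inter>i\<in>{..<n}. {y \<in> X. y i = x i})"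
    by (auto simp: cylinder_def)
  ultimately show ?thesis
    by (simp add: sets_shift_borel)
qed

section \<open>Projected measure of cylinders and its invariance\<close>

lemma block_map_vimage_cylinder:
  "block_map p -` cylinder (range (block_map p)) n y
    = (\<Union>z\<in>fibre_words p n y x. cylinder UNIV n z)"
proof (rule set_eqI)
  fix w
  \<comment> \<open>A point \<open>w\<close> of the preimage lies in the cylinder of the fibre word
    that keeps the first \<open>n\<close> letters of \<open>w\<close> and continues with the tail
    \<open>x\<close>.\<close>
  let ?z = "\<lambda>i. if i < n then w i else x (i - n)"
  have "?z \<in> fibre_words p n y x \<longleftrightarrow> (\<forall>i<n. p (w i) = y i)"
    by (auto simp: fibre_words_def left_shift_funpow)
  moreover have "w \<in> cylinder UNIV n ?z"
    by (simp add: cylinder_def)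
  ultimately show "w \<in> block_map p -` cylinder (range (block_map p)) n y \<longleftrightarrow>
      w \<in> (\<Union>z\<in>fibre_words p n y x. cylinder UNIV n z)"
    by (auto simp: cylinder_def block_map_def fibre_words_def)
qed

text \<open>Fibre words share the tail \<open>x\<close>, so distinct ones already differ within the
  first \<open>n\<close> letters.\<close>

lemma disjoint_cylinders_fibre_words:
  "disjoint_family_on (cylinder UNIV n) (fibre_words p n y x)"
  unfolding disjoint_family_on_def
proof (intro ballI impI)
  fix z z'
  assume z: "z \<in> fibre_words p n y x" "z' \<in> fibre_words p n y x" "z \<noteq> z'"
  have "z = z'" if "\<forall>i<n. z i = z' i"
  proof
    fix i
    show "z i = z' i"
    proof (cases "i < n")
      case False
      then obtain j where "i = n + j"
        using le_Suc_ex not_less by blast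
      then show ?thesis
        using z(1,2) by (auto simp: fibre_words_def left_shift_funpow fun_eq_iff)
    qed (use that in simp)
  qed
  then show "cylinder UNIV n z \<inter> cylinder UNIV n z' = {}"
    using z(3) by (fastforce simp: cylinder_def)
qed

lemma measure_block_map_cylinder:
  fixes p :: "'a::finite \<Rightarrow> 'b"
  assumes "prob_space \<mu>" and sets: "sets \<mu> = sets (shift_borel UNIV)"
  defines "Y \<equiv> range (block_map p)"
  shows "measure (distr \<mu> (shift_borel Y) (block_map p)) (cylinder Y n y)
    = (\<Sum>z\<in>fibre_words p n y x. measure \<mu> (cylinder UNIV n z))"
proof -
  interpret prob_space \<mu> by fact
  have space: "space \<mu> = UNIV"
    using sets_eq_imp_space_eq[OF sets] by simp
  have "block_map p \<in> \<mu> \<rightarrow>\<^sub>M shift_borel Y"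
    unfolding Y_def using measurable_block_map measurable_cong_sets[OF sets refl] by blast
  then have "measure (distr \<mu> (shift_borel Y) (block_map p)) (cylinder Y n y)
      = measure \<mu> (block_map p -` cylinder Y n y)"
    using measure_distr[of "block_map p" \<mu> "shift_borel Y" "cylinder Y n y"]
    by (simp add: space cylinder_sets)
  also have "\<dots> = (\<Sum>z\<in>fibre_words p n y x. measure \<mu> (cylinder UNIV n z))"
    unfolding Y_def block_map_vimage_cylinder[of p n y x]
    using cylinder_sets by (intro finite_measure_finite_Union finite_fibre_words
        disjoint_cylinders_fibre_words) (auto simp: sets)
  finally show ?thesis .
qed

text \<open>Invariance descends because \<open>block_map p\<close> commutes with
  \<open>left_shift\<close>.\<close>

lemma measure_distr_left_shift:
  fixes p :: "'a \<Rightarrow> 'b"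
  assumes "prob_space \<mu>" and sets: "sets \<mu> = sets (shift_borel UNIV)"
    and inv: "\<And>E. E \<in> sets \<mu> \<Longrightarrow> measure \<mu> {x. left_shift x \<in> E} = measure \<mu> E"
  defines "Y \<equiv> range (block_map p)"
  assumes E: "E \<in> sets (shift_borel Y)"
  shows "measure (distr \<mu> (shift_borel Y) (block_map p)) {y \<in> Y. left_shift y \<in> E}
    = measure (distr \<mu> (shift_borel Y) (block_map p)) E"
proof -
  have space: "space \<mu> = UNIV"
    using sets_eq_imp_space_eq[OF sets] by simp
  have \<pi>: "block_map p \<in> \<mu> \<rightarrow>\<^sub>M shift_borel Y"
    unfolding Y_def using measurable_block_map measurable_cong_sets[OF sets refl] by blast
  have commute: "left_shift (block_map p x) = block_map p (left_shift x)" for x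
    by (simp add: left_shift_def block_map_def)
  have "left_shift y \<in> Y" if "y \<in> Y" for y
    using that commute by (auto simp: Y_def)
  then have "left_shift -` E \<inter> space (shift_borel Y) \<in> sets (shift_borel Y)"
    by (intro measurable_sets[OF measurable_left_shift E])
  moreover have "left_shift -` E \<inter> space (shift_borel Y) = {y \<in> Y. left_shift y \<in> E}"
    by auto
  ultimately have E': "{y \<in> Y. left_shift y \<in> E} \<in> sets (shift_borel Y)"
    by simp
  have "block_map p -` E \<in> sets \<mu>"
    using measurable_sets[OF \<pi> E] by (simp add: space)
  then have "measure \<mu> {x. left_shift x \<in> block_map p -` E} = measure \<mu> (block_map p -` E)"
    by (rule inv)
  moreover have "{x. left_shift x \<in> block_map p -` E} = block_map p -` {y \<in> Y. left_shift y \<in> E}"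
    by (auto simp: Y_def commute)
  ultimately show ?thesis
    using measure_distr[OF \<pi> E] measure_distr[OF \<pi> E'] by (simp add: space)
qed

section \<open>The projected Gibbs state\<close>

lemma abs_diff_le_var:
  assumes "var UNIV n \<phi> \<le> ereal r" "\<And>i. i < n \<Longrightarrow> x i = y i"
  shows "\<bar>\<phi> x - \<phi> y\<bar> \<le> r"
proof -
  have "ereal \<bar>\<phi> x - \<phi> y\<bar> \<le> var UNIV n \<phi>"
    unfolding var_def using assms(2) by (intro Sup_upper) blast
  then have "ereal \<bar>\<phi> x - \<phi> y\<bar> \<le> ereal r"
    using assms(1) by (rule order_trans)
  then show ?thesis
    by simp
qed

lemma var_le:
  assumes "\<And>x y. x \<in> X \<Longrightarrow> y \<in> X \<Longrightarrow> (\<And>i. i < n \<Longrightarrow> x i = y i) \<Longrightarrow> \<bar>\<psi> x - \<psi> y\<bar> \<le> r"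
  shows "var X n \<psi> \<le> ereal r"
  unfolding var_def using assms by (intro Sup_least) auto

theorem mainTheorem2:
  fixes \<phi> :: "(nat \<Rightarrow> 'a::finite) \<Rightarrow> real"
    and p :: "'a \<Rightarrow> 'b::finite"
    and \<mu> :: "(nat \<Rightarrow> 'a) measure"
    and \<theta> \<sigma> K \<eta> :: real
    and Y :: "(nat \<Rightarrow> 'b) set"
  assumes "0 < \<theta>" and "\<theta> < 1"
    and "0 \<le> K"
    and "\<And>n. n \<ge> 1 \<Longrightarrow> var UNIV n \<phi> \<le> ereal (K * \<theta> ^ n)"
    and "gibbs_state UNIV \<phi> \<mu>"
    and "\<theta> < \<sigma>" and "\<sigma> < 1"
  defines "Y \<equiv> range (block_map p)"
    and "\<eta> \<equiv> tanh (1/2 * (ln ((1 + \<sigma>) / (1 - \<sigma>)) + \<sigma> * (K * \<theta> / (\<sigma> - \<theta>))))"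
  shows "\<exists>\<psi> :: (nat \<Rightarrow> 'b) \<Rightarrow> real.
           gibbs_state Y \<psi> (distr \<mu> (shift_borel Y) (block_map p)) \<and>
           (\<exists>C. \<forall>n\<ge>1. var Y n \<psi> \<le> ereal (C * \<eta> ^ n))"
proof -
  interpret fibred_potential \<phi> p \<theta> \<sigma> K
    using assms(1,3,6,7) by unfold_locales (auto simp del: power_Suc intro: abs_diff_le_var[OF assms(4)])
  have \<eta>: "\<eta> = rate"
    unfolding \<eta>_def rate_eq_tanh ..
  obtain C P where prob: "prob_space \<mu>" and sets: "sets \<mu> = sets (shift_borel UNIV)"
    and inv: "\<And>E. E \<in> sets \<mu> \<Longrightarrow> measure \<mu> {x. left_shift x \<in> E} = measure \<mu> E"
    and C: "1 \<le> C"
    and gibbs: "\<And>z n. n \<ge> 1 \<Longrightarrow>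
      inverse C * exp (- P * real n + (\<Sum>k<n. \<phi> ((left_shift ^^ k) z))) \<le> measure \<mu> (cylinder UNIV n z) \<and>
      measure \<mu> (cylinder UNIV n z) \<le> C * exp (- P * real n + (\<Sum>k<n. \<phi> ((left_shift ^^ k) z)))"
    using assms(5) unfolding gibbs_state_def
    by (auto simp: Let_def pos_le_divide_eq pos_divide_le_eq)
  obtain \<psi> B where var\<psi>: "\<And>n y y'. y \<in> Y \<Longrightarrow> y' \<in> Y \<Longrightarrow> n \<ge> 1 \<Longrightarrow>
      (\<And>i. i < n \<Longrightarrow> y i = y' i) \<Longrightarrow> \<bar>\<psi> y - \<psi> y'\<bar> \<le> B * rate ^ n"
    and sum\<psi>: "\<And>n y x. y \<in> Y \<Longrightarrow>
      \<bar>ln (partition_fun \<phi> p n y x) - (\<Sum>k<n. \<psi> ((left_shift ^^ k) y))\<bar> \<le> B"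
    unfolding Y_def using projected_potential by blast
  let ?\<nu> = "distr \<mu> (shift_borel Y) (block_map p)"
  have \<pi>: "block_map p \<in> \<mu> \<rightarrow>\<^sub>M shift_borel Y"
    unfolding Y_def using measurable_block_map measurable_cong_sets[OF sets refl] by blast
  \<comment> \<open>The constant \<open>P\<close> of \<open>\<phi>\<close> also serves
    \<open>\<psi>\<close>; only the multiplicative constant grows, by the factor
    \<open>exp B\<close> from replacing the partition function by \<open>exp\<close> of a Birkhoff
    sum.\<close>
  have ratio: "inverse (C * exp B) \<le> r \<and> r \<le> C * exp B"
    if y: "y \<in> Y" and n: "n \<ge> 1"
      and r: "r = measure ?\<nu> (cylinder Y n y) / exp (- P * real n + (\<Sum>k<n. \<psi> ((left_shift ^^ k) y)))"
    for y n r
  proof -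
    \<comment> \<open>Any tail will do: the projected mass does not involve \<open>x\<close>, and
      the estimates used hold for every \<open>x\<close>.\<close>
    fix x :: "nat \<Rightarrow> 'a"
    let ?Z = "partition_fun \<phi> p n y x" and ?S = "\<Sum>k<n. \<psi> ((left_shift ^^ k) y)"
      and ?m = "measure ?\<nu> (cylinder Y n y)"
    have m: "?m = (\<Sum>z\<in>fibre_words p n y x. measure \<mu> (cylinder UNIV n z))"
      unfolding Y_def by (rule measure_block_map_cylinder[OF prob sets])
    have Z: "t * exp (- P * real n) * ?Z = (\<Sum>z\<in>fibre_words p n y x.
        t * exp (- P * real n + (\<Sum>k<n. \<phi> ((left_shift ^^ k) z))))" for t
      unfolding partition_fun_eq_sum sum_distrib_left by (simp only: exp_add mult.assoc)
    \<comment> \<open>The Gibbs bounds for \<open>\<mu>\<close> are summed over the fibre words,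
      whose cylinders partition the preimage of the cylinder of \<open>y\<close>.\<close>
    have lower: "inverse C * exp (- P * real n) * ?Z \<le> ?m"
      and upper: "?m \<le> C * exp (- P * real n) * ?Z"
      unfolding m Z using gibbs[OF n] by (auto intro: sum_mono)
    have Zpos: "0 < ?Z"
      using y unfolding Y_def by (rule partition_fun_pos)
    have "exp (?S - B) \<le> exp (ln ?Z)" "exp (ln ?Z) \<le> exp (?S + B)"
      using sum\<psi>[OF y, of n x] unfolding exp_le_cancel_iff by linarith+
    then have ZS: "exp (?S - B) \<le> ?Z" "?Z \<le> exp (?S + B)"
      using Zpos by simp_all
    have "inverse (C * exp B) * exp (- P * real n + ?S) = inverse C * exp (- P * real n) * exp (?S - B)"
      by (simp only: exp_add exp_diff divide_inverse inverse_mult_distrib mult_ac)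
    also have "\<dots> \<le> inverse C * exp (- P * real n) * ?Z"
      using ZS C by (intro mult_left_mono) auto
    finally have 1: "inverse (C * exp B) * exp (- P * real n + ?S) \<le> ?m"
      using lower by linarith
    have "C * exp (- P * real n) * ?Z \<le> C * exp (- P * real n) * exp (?S + B)"
      using ZS C by (intro mult_left_mono) auto
    also have "\<dots> = C * exp B * exp (- P * real n + ?S)"
      by (simp only: exp_add mult_ac)
    finally have 2: "?m \<le> C * exp B * exp (- P * real n + ?S)"
      using upper by linarith
    show ?thesis
      unfolding r using 1 2 by (simp add: pos_le_divide_eq pos_divide_le_eq)
  qed
  \<comment> \<open>Read off from \<open>n = 0\<close>, where the partition function is 1 and the
    Birkhoff sum is empty; it ensures that the new Gibbs constant is at least 1.\<close>
  have "0 \<le> B"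
  proof -
    have "block_map p undefined \<in> Y"
      by (simp add: Y_def)
    from sum\<psi>[OF this, of 0 undefined] show ?thesis
      by simp
  qed
  then have CB: "1 \<le> C * exp B"
    using C mult_mono[of 1 C 1 "exp B"] by simp
  have "gibbs_state Y \<psi> ?\<nu>"
    unfolding gibbs_state_def Let_def
  proof (intro conjI ballI)
    show "prob_space ?\<nu>"
      using prob \<pi> by (rule prob_space.prob_space_distr)
    show "measure ?\<nu> {x \<in> Y. left_shift x \<in> E} = measure ?\<nu> E" if "E \<in> sets ?\<nu>" for E
      using measure_distr_left_shift[OF prob sets inv] that unfolding Y_def by simp
    show "\<exists>C P. 1 \<le> C \<and> (\<forall>y\<in>Y. \<forall>n\<ge>1.
        inverse C \<le> measure ?\<nu> (cylinder Y n y) /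
          exp (- P * real n + (\<Sum>k<n. \<psi> ((left_shift ^^ k) y))) \<and>
        measure ?\<nu> (cylinder Y n y) /
          exp (- P * real n + (\<Sum>k<n. \<psi> ((left_shift ^^ k) y))) \<le> C)"
      using CB ratio[OF _ _ refl] by blast
  qed simp
  moreover have "var Y n \<psi> \<le> ereal (B * \<eta> ^ n)" if "n \<ge> 1" for n
    unfolding \<eta> using var\<psi>[OF _ _ that] by (rule var_le)
  ultimately show ?thesis
    by blast
qed

end
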